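(* Let $\mathcal{C}$ denote the class of all groups $G$ such that $\mathcal{V}_\omega(\mathbb{Z}G)=\{1\}$, and let $\operatorname{Disc}\mathcal{C}$ denote the class of all groups discriminated by the class $\mathcal{C}$. Then $\mathcal{C}=\operatorname{Disc}\mathcal{C}$.
   Context: For a group $G$, $\mathbb{Z}G$ is the integral group ring, $\Delta(G)$ is its augmentation ideal, and $\Delta^n(G)$ is the $n$-th power of this ideal. $\mathcal{V}(\mathbb{Z}G)$ is the group of units of augmentation one in $\mathbb{Z}G$; for $n\ge 1$, $\mathcal{V}_n(\mathbb{Z}G)=\mathcal{V}(\mathbb{Z}G)\cap(1+\Delta^n(G))$; and $\mathcal{V}_\omega(\mathbb{Z}G)=\bigcap_{n=1}^\infty\mathcal{V}_n(\mathbb{Z}G)$. A group $G$ is discriminated by a class $\mathbf{C}$ of groups if, for every finite set $g_1,\ldots,g_n$ of distinct elements of $G$, there exist a group $H\in\mathbf{C}$ and a homomorphism $\varphi:G\to H$ such that $\varphi(g_i)\neq\varphi(g_j)$ for $i\ne j$. *)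

theory Defs
  imports "HOL-Algebra.Algebra" "HOL-Library.Poly_Mapping"
begin

(* Elements of the integral group ring are the finitely supported integer-valued functions
   supported on the carrier of G; multiplication is the bilinear extension of that of G. *)
definition group_ring :: "'a monoid \<Rightarrow> ('a \<Rightarrow>\<^sub>0 int) ring" where
  "group_ring G = \<lparr>carrier = {x. Poly_Mapping.keys x \<subseteq> carrier G},
     monoid.mult = (\<lambda>x y. frag_extend (\<lambda>g. frag_extend (\<lambda>h. frag_of (g \<otimes>\<^bsub>G\<^esub> h)) y) x),
     one = frag_of \<one>\<^bsub>G\<^esub>, ring.zero = 0, ring.add = (+)\<rparr>"

definition augmentation :: "('a \<Rightarrow>\<^sub>0 int) \<Rightarrow> int" where
  "augmentation x = (\<Sum>g\<in>Poly_Mapping.keys x. Poly_Mapping.lookup x g)"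

definition augmentation_ideal :: "'a monoid \<Rightarrow> ('a \<Rightarrow>\<^sub>0 int) set" where
  "augmentation_ideal G = a_kernel (group_ring G) \<Z> augmentation"

(* The power is taken in the multiplicative monoid of two-sided ideals, so that the 0-th power
   is the whole ring and I ^ (n + 1) consists of the finite sums of products of an element
   of I ^ n and an element of I. *)
definition augmentation_power :: "'a monoid \<Rightarrow> nat \<Rightarrow> ('a \<Rightarrow>\<^sub>0 int) set" where
  "augmentation_power G n = augmentation_ideal G [^]\<^bsub>ideals_set (group_ring G)\<^esub> n"

definition normalized_units :: "'a monoid \<Rightarrow> ('a \<Rightarrow>\<^sub>0 int) set" where
  "normalized_units G = {u \<in> Units (group_ring G). augmentation u = 1}"

definition normalized_units_n :: "'a monoid \<Rightarrow> nat \<Rightarrow> ('a \<Rightarrow>\<^sub>0 int) set" where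
  "normalized_units_n G n =
     normalized_units G \<inter> (\<one>\<^bsub>group_ring G\<^esub> <+\<^bsub>group_ring G\<^esub> augmentation_power G n)"

definition normalized_units_omega :: "'a monoid \<Rightarrow> ('a \<Rightarrow>\<^sub>0 int) set" where
  "normalized_units_omega G = (\<Inter>n\<in>{1..}. normalized_units_n G n)"

(* The class of all groups with this property has no HOL type; this constant is its part
   consisting of the groups with carrier in the type 'a. *)
definition omega_trivial_groups :: "'a monoid set" where
  "omega_trivial_groups =
     {G. group G \<and> normalized_units_omega G = {\<one>\<^bsub>group_ring G\<^esub>}}"

(* The discriminating groups (type 'b) and the discriminated ones (type 'a) need not live in
   the same type. A homomorphism separates the members of a finite set S of elements of G
   precisely when it is injective on S. *)
definition Disc :: "'b monoid set \<Rightarrow> 'a monoid set" where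
  "Disc K = {G. group G \<and>
     (\<forall>S. finite S \<and> S \<subseteq> carrier G \<longrightarrow> (\<exists>H\<in>K. \<exists>\<phi>\<in>hom G H. inj_on \<phi> S))}"

end

theory Submission
  imports Defs
begin

text \<open>
  A homomorphism of groups extends linearly to a homomorphism of integral group rings that
  preserves augmentation and hence carries each power of the augmentation ideal into the
  corresponding power; so it maps \<open>\<V>\<^sub>\<omega>(\<int>G)\<close> into \<open>\<V>\<^sub>\<omega>(\<int>H)\<close>
  (lemma \<open>frag_map_normalized_units_omega\<close>).  An element \<open>u\<close> of the source has finite
  support, so discrimination provides a homomorphism into some \<open>H\<close> of the class that is
  injective on the support of \<open>u\<close> together with the identity.  Its linear extension sends \<open>u\<close> to
  \<open>1\<close> because \<open>H\<close> lies in the class, and by injectivity on the support nothing has cancelled or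
  merged, so that \<open>u = 1\<close> already (lemma \<open>frag_map_inj_on\<close>).  The converse inclusion holds
  since the identity of a group is injective on every subset.
\<close>

definition frag_map :: "('a \<Rightarrow> 'b) \<Rightarrow> ('a \<Rightarrow>\<^sub>0 int) \<Rightarrow> ('b \<Rightarrow>\<^sub>0 int)" where
  "frag_map \<phi> = frag_extend (frag_of \<circ> \<phi>)"

lemma frag_map_of [simp]: "frag_map \<phi> (frag_of g) = frag_of (\<phi> g)"
  by (simp add: frag_map_def)

lemma frag_map_zero [simp]: "frag_map \<phi> 0 = 0"
  by (simp add: frag_map_def)

lemma frag_map_add: "frag_map \<phi> (x + y) = frag_map \<phi> x + frag_map \<phi> y"
  by (simp add: frag_map_def frag_extend_add)

lemma frag_map_diff: "frag_map \<phi> (x - y) = frag_map \<phi> x - frag_map \<phi> y"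
  by (simp add: frag_map_def frag_extend_diff)

lemma keys_frag_map: "Poly_Mapping.keys (frag_map \<phi> x) \<subseteq> \<phi> ` Poly_Mapping.keys x"
  using keys_frag_extend [of "frag_of \<circ> \<phi>" x] by (auto simp: frag_map_def)

text \<open>A left inverse of \<open>\<phi>\<close> on \<open>S\<close> induces a left inverse of the linear extension on
  the elements supported in \<open>S\<close>.\<close>

lemma frag_map_inj_on:
  assumes "inj_on \<phi> S" "Poly_Mapping.keys x \<subseteq> S" "Poly_Mapping.keys y \<subseteq> S"
    and "frag_map \<phi> x = frag_map \<phi> y"
  shows "x = y"
proof -
  have left_inverse: "frag_map (inv_into S \<phi>) (frag_map \<phi> z) = z"
    if "Poly_Mapping.keys z \<subseteq> S" for z
    using that
  proof (induction z rule: frag_induction)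
    case (one g)
    with assms(1) show ?case by simp
  qed (simp_all add: frag_map_diff)
  show ?thesis
    using left_inverse [OF assms(2)] left_inverse [OF assms(3)] assms(4) by metis
qed

lemma augmentation_superset:
  assumes "finite A" "Poly_Mapping.keys x \<subseteq> A"
  shows "augmentation x = (\<Sum>g\<in>A. Poly_Mapping.lookup x g)"
  unfolding augmentation_def using assms
  by (intro sum.mono_neutral_left) (auto simp: in_keys_iff)

lemma augmentation_zero [simp]: "augmentation 0 = 0"
  by (simp add: augmentation_def)

lemma augmentation_of [simp]: "augmentation (frag_of g) = 1"
  by (simp add: augmentation_def)

lemma augmentation_diff: "augmentation (x - y) = augmentation x - augmentation y"
proof -
  let ?A = "Poly_Mapping.keys x \<union> Poly_Mapping.keys y"
  have "Poly_Mapping.keys (x - y) \<subseteq> ?A"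
    by (rule keys_diff)
  then show ?thesis
    by (simp add: augmentation_superset [of ?A] lookup_minus sum_subtractf)
qed

lemma augmentation_frag_map [simp]: "augmentation (frag_map \<phi> x) = augmentation x"
proof -
  have "Poly_Mapping.keys x \<subseteq> UNIV" by simp
  then show ?thesis
    by (induction x rule: frag_induction) (simp_all add: frag_map_diff augmentation_diff)
qed

lemma group_ring_simps [simp]:
  "carrier (group_ring G) = {x. Poly_Mapping.keys x \<subseteq> carrier G}"
  "x \<otimes>\<^bsub>group_ring G\<^esub> y = frag_extend (\<lambda>g. frag_extend (\<lambda>h. frag_of (g \<otimes>\<^bsub>G\<^esub> h)) y) x"
  "\<one>\<^bsub>group_ring G\<^esub> = frag_of \<one>\<^bsub>G\<^esub>"
  "\<zero>\<^bsub>group_ring G\<^esub> = 0"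
  "x \<oplus>\<^bsub>group_ring G\<^esub> y = x + y"
  by (simp_all add: group_ring_def)

lemma frag_map_carrier:
  assumes "\<phi> \<in> hom G H" "x \<in> carrier (group_ring G)"
  shows "frag_map \<phi> x \<in> carrier (group_ring H)"
  using keys_frag_map [of \<phi> x] assms by (auto simp: hom_def)

text \<open>Both sides are additive in \<open>x\<close> and in \<open>y\<close>, so it suffices to compare them on group
  elements: first \<open>y\<close> is reduced to these for a group element \<open>x\<close>, then \<open>x\<close>.\<close>

lemma frag_map_mult:
  assumes hom: "\<phi> \<in> hom G H" and x: "x \<in> carrier (group_ring G)"
    and y: "y \<in> carrier (group_ring G)"
  shows "frag_map \<phi> (x \<otimes>\<^bsub>group_ring G\<^esub> y)
       = frag_map \<phi> x \<otimes>\<^bsub>group_ring H\<^esub> frag_map \<phi> y"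
proof -
  have basis: "frag_map \<phi> (frag_of g \<otimes>\<^bsub>group_ring G\<^esub> y)
      = frag_of (\<phi> g) \<otimes>\<^bsub>group_ring H\<^esub> frag_map \<phi> y" if "g \<in> carrier G" for g
  proof -
    have "Poly_Mapping.keys y \<subseteq> carrier G" using y by simp
    then show ?thesis
    proof (induction y rule: frag_induction)
      case (one h)
      with that hom show ?case by (simp add: hom_mult)
    qed (simp_all add: frag_map_diff frag_extend_diff)
  qed
  have "Poly_Mapping.keys x \<subseteq> carrier G" using x by simp
  then show ?thesis
  proof (induction x rule: frag_induction)
    case (one g)
    then show ?case using basis by simp
  qed (simp_all add: frag_map_diff frag_extend_diff)
qed

lemma augmentation_ideal_iff:
  "x \<in> augmentation_ideal G \<longleftrightarrow> x \<in> carrier (group_ring G) \<and> augmentation x = 0"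
  by (simp add: augmentation_ideal_def a_kernel_def kernel_def)

lemma augmentation_power_0: "augmentation_power G 0 = carrier (group_ring G)"
  by (simp add: augmentation_power_def ideals_set_def)

lemma augmentation_power_Suc:
  "augmentation_power G (Suc n)
     = ideal_prod (group_ring G) (augmentation_power G n) (augmentation_ideal G)"
  by (simp add: augmentation_power_def ideals_set_def)

lemma group_ring_mult_closed:
  assumes "group G" "x \<in> carrier (group_ring G)" "y \<in> carrier (group_ring G)"
  shows "x \<otimes>\<^bsub>group_ring G\<^esub> y \<in> carrier (group_ring G)"
proof -
  interpret group G by fact
  have "Poly_Mapping.keys (frag_extend (\<lambda>h. frag_of (g \<otimes>\<^bsub>G\<^esub> h)) y) \<subseteq> carrier G"
    if "g \<in> carrier G" for g
    using that assms(3) by (intro order_trans [OF keys_frag_extend]) auto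
  then have "Poly_Mapping.keys (frag_extend (\<lambda>g. frag_extend (\<lambda>h. frag_of (g \<otimes>\<^bsub>G\<^esub> h)) y) x)
      \<subseteq> carrier G"
    using assms(2) by (intro order_trans [OF keys_frag_extend]) auto
  then show ?thesis by simp
qed

lemma augmentation_power_subset:
  assumes "group G"
  shows "augmentation_power G n \<subseteq> carrier (group_ring G)"
proof (induction n)
  case (Suc n)
  show ?case
  proof
    fix x
    assume "x \<in> augmentation_power G (Suc n)"
    then show "x \<in> carrier (group_ring G)"
      unfolding augmentation_power_Suc
    proof (induction rule: ideal_prod.induct)
      case (prod i j)
      with Suc assms show ?case
        by (intro group_ring_mult_closed) (auto simp only: augmentation_ideal_iff)
    next
      case (sum s t)
      then show ?case using Poly_Mapping.keys_add [of s t] by auto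
    qed
  qed
qed (simp add: augmentation_power_0)

lemma zero_in_augmentation_power: "0 \<in> augmentation_power G n"
proof (induction n)
  case (Suc n)
  then have "0 \<otimes>\<^bsub>group_ring G\<^esub> 0 \<in> augmentation_power G (Suc n)"
    unfolding augmentation_power_Suc
    by (intro ideal_prod.prod) (simp_all add: augmentation_ideal_iff)
  then show ?case by simp
qed (simp add: augmentation_power_0)

text \<open>Additivity and multiplicativity carry finite sums of products to finite sums of
  products; the individual factors stay in the augmentation ideal because augmentation is
  preserved.\<close>

lemma frag_map_augmentation_power:
  assumes "group G" "\<phi> \<in> hom G H" "x \<in> augmentation_power G n"
  shows "frag_map \<phi> x \<in> augmentation_power H n"
  using assms(3)
proof (induction n arbitrary: x)
  case 0
  with assms(2) show ?case
    unfolding augmentation_power_0 by (rule frag_map_carrier)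
next
  case (Suc n)
  from Suc.prems show ?case
    unfolding augmentation_power_Suc
  proof (induction rule: ideal_prod.induct)
    case (prod i j)
    have "i \<in> carrier (group_ring G)"
      using prod(1) augmentation_power_subset [OF assms(1)] by blast
    moreover have "j \<in> carrier (group_ring G)"
      using prod(2) by (simp only: augmentation_ideal_iff)
    moreover have "frag_map \<phi> j \<in> augmentation_ideal H"
      using prod(2) frag_map_carrier [OF assms(2)] unfolding augmentation_ideal_iff by simp
    ultimately show ?case
      using Suc.IH [OF prod(1)] assms(2) by (simp only: frag_map_mult ideal_prod.prod)
  next
    case (sum s t)
    from ideal_prod.sum [OF sum.IH] show ?case
      by (simp add: frag_map_add)
  qed
qed

text \<open>Writing the coset condition as a difference lets additivity of the linear extension
  act on it directly.\<close>

lemma normalized_units_omega_iff: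
  "u \<in> normalized_units_omega G \<longleftrightarrow>
     u \<in> Units (group_ring G) \<and> augmentation u = 1 \<and>
     (\<forall>n\<ge>1. u - \<one>\<^bsub>group_ring G\<^esub> \<in> augmentation_power G n)"
proof -
  have coset: "u \<in> \<one>\<^bsub>group_ring G\<^esub> <+\<^bsub>group_ring G\<^esub> augmentation_power G n
      \<longleftrightarrow> u - \<one>\<^bsub>group_ring G\<^esub> \<in> augmentation_power G n" for n
    by (auto simp: a_l_coset_def' algebra_simps intro: bexI [of _ "u - frag_of \<one>\<^bsub>G\<^esub>"])
  show ?thesis
    unfolding normalized_units_omega_def normalized_units_n_def normalized_units_def
    by (auto simp only: coset INT_iff atLeast_iff Int_iff mem_Collect_eq)
qed

lemma one_in_normalized_units_omega:
  assumes "group G"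
  shows "\<one>\<^bsub>group_ring G\<^esub> \<in> normalized_units_omega G"
proof -
  interpret group G by fact
  show ?thesis
    by (auto simp: normalized_units_omega_iff Units_def zero_in_augmentation_power
        intro!: exI [of _ "frag_of \<one>\<^bsub>G\<^esub>"] bexI [of _ "frag_of \<one>\<^bsub>G\<^esub>"])
qed

lemma frag_map_Units:
  assumes "group G" "group H" "\<phi> \<in> hom G H" "u \<in> Units (group_ring G)"
  shows "frag_map \<phi> u \<in> Units (group_ring H)"
proof -
  obtain v where u: "u \<in> carrier (group_ring G)" and v: "v \<in> carrier (group_ring G)"
    and inverse: "v \<otimes>\<^bsub>group_ring G\<^esub> u = \<one>\<^bsub>group_ring G\<^esub>"
      "u \<otimes>\<^bsub>group_ring G\<^esub> v = \<one>\<^bsub>group_ring G\<^esub>"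
    using assms(4) unfolding Units_def by blast
  have one: "frag_map \<phi> \<one>\<^bsub>group_ring G\<^esub> = \<one>\<^bsub>group_ring H\<^esub>"
    using assms(1-3) by (simp add: hom_one)
  have "frag_map \<phi> v \<otimes>\<^bsub>group_ring H\<^esub> frag_map \<phi> u = \<one>\<^bsub>group_ring H\<^esub>"
    "frag_map \<phi> u \<otimes>\<^bsub>group_ring H\<^esub> frag_map \<phi> v = \<one>\<^bsub>group_ring H\<^esub>"
    using frag_map_mult [OF assms(3)] u v inverse one by metis+
  then show ?thesis
    using frag_map_carrier [OF assms(3)] u v unfolding Units_def by blast
qed

lemma frag_map_normalized_units_omega:
  assumes "group G" "group H" "\<phi> \<in> hom G H" "u \<in> normalized_units_omega G"
  shows "frag_map \<phi> u \<in> normalized_units_omega H"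
proof -
  have "frag_map \<phi> u - \<one>\<^bsub>group_ring H\<^esub> = frag_map \<phi> (u - \<one>\<^bsub>group_ring G\<^esub>)"
    using assms(1-3) by (simp add: frag_map_diff hom_one)
  then show ?thesis
    using assms(4) frag_map_Units [OF assms(1-3)] frag_map_augmentation_power [OF assms(1,3)]
    unfolding normalized_units_omega_iff by simp
qed

lemma subset_Disc:
  assumes "\<And>G. G \<in> K \<Longrightarrow> group G"
  shows "K \<subseteq> Disc K"
proof
  fix G
  assume G: "G \<in> K"
  have "(\<lambda>g. g) \<in> hom G G"
    by (simp add: hom_def)
  with G assms show "G \<in> Disc K"
    unfolding Disc_def by (auto intro!: bexI [of _ G] bexI [of _ "\<lambda>g. g"])
qed

text \<open>The set \<open>S\<close> below contains the identity of \<open>G\<close> besides the support of \<open>u\<close>: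
  injectivity on the support alone would not exclude that \<open>u\<close> is a single nontrivial element
  of \<open>G\<close> lying in the kernel of \<open>\<phi>\<close>.\<close>

lemma Disc_omega_trivial_groups:
  "Disc (omega_trivial_groups :: 'b monoid set) \<subseteq> (omega_trivial_groups :: 'a monoid set)"
proof
  fix G :: "'a monoid"
  assume Disc: "G \<in> Disc (omega_trivial_groups :: 'b monoid set)"
  then have G: "group G"
    by (simp add: Disc_def)
  have "u = \<one>\<^bsub>group_ring G\<^esub>" if u: "u \<in> normalized_units_omega G" for u
  proof -
    define S where "S = insert \<one>\<^bsub>G\<^esub> (Poly_Mapping.keys u)"
    have "Poly_Mapping.keys u \<subseteq> carrier G"
      using u by (simp add: normalized_units_omega_iff Units_def)
    then have "finite S" "S \<subseteq> carrier G"
      using G by (simp_all add: S_def group.is_monoid)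
    with Disc obtain H :: "'b monoid" and \<phi> where H: "H \<in> omega_trivial_groups"
      and \<phi>: "\<phi> \<in> hom G H" "inj_on \<phi> S"
      unfolding Disc_def by blast
    from H have "group H" and "normalized_units_omega H = {\<one>\<^bsub>group_ring H\<^esub>}"
      by (simp_all add: omega_trivial_groups_def)
    then have "frag_map \<phi> u = \<one>\<^bsub>group_ring H\<^esub>"
      using frag_map_normalized_units_omega [OF G _ \<phi>(1) u] by blast
    also have "\<dots> = frag_map \<phi> \<one>\<^bsub>group_ring G\<^esub>"
      using G \<open>group H\<close> \<phi>(1) by (simp add: hom_one)
    finally show ?thesis
      by (rule frag_map_inj_on [OF \<phi>(2), rotated 2]) (auto simp: S_def)
  qed
  with one_in_normalized_units_omega [OF G] G show "G \<in> omega_trivial_groups"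
    unfolding omega_trivial_groups_def by blast
qed

theorem theorem15:
  shows "(omega_trivial_groups :: 'a monoid set) = Disc (omega_trivial_groups :: 'a monoid set) \<and>
         Disc (omega_trivial_groups :: 'b monoid set) \<subseteq> (omega_trivial_groups :: 'a monoid set)"
proof (intro conjI antisym Disc_omega_trivial_groups subset_Disc)
  show "group G" if "G \<in> omega_trivial_groups" for G :: "'a monoid"
    using that by (simp add: omega_trivial_groups_def)
qed

end
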